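(* Assume that (i) $\sum_{\nu\in\mathbb{N}}\alpha_{\nu,j}^{-1}\nu^{-1/2}<\infty$ for every $j\in\mathbb{N}$ and $\alpha_{\nu,j}\le\alpha_{\nu+1,j}$ for all $\nu,j\in\mathbb{N}$, and (ii) $\sum_{j\in\mathbb{N}}|\alpha_{0,j}-1|<\infty$. Then the maximal domain for $K$ is given by $$\mathfrak{X}:=\Bigl\{\boldsymbol{x}\in\mathbb{R}^{\mathbb{N}}:\sum_{j\in\mathbb{N}}k_j^*(x_j,x_j)<\infty\Bigr\}.$$ Moreover, $$K(\boldsymbol{x},\boldsymbol{y})=\sum_{\mathfrak{u}\in\boldsymbol{U}}c_{\mathfrak{u}}\cdot k^*_{\mathfrak{u}}(\boldsymbol{x},\boldsymbol{y}),\qquad \boldsymbol{x},\boldsymbol{y}\in\mathfrak{X},$$ with absolute convergence.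
   Context: $\mathbb{N}=\{1,2,\dots\}$, $\mathbb{N}_0=\mathbb{N}\cup\{0\}$. Let $\alpha_{\nu,j}\in\,]0,\infty[$ for $\nu\in\mathbb{N}_0$, $j\in\mathbb{N}$. $h_\nu$ are the Hermite polynomials normalized in $L^2$ of the standard normal distribution: $h_\nu(x)=\sqrt{\nu!}\sum_{k=0}^{\lfloor \nu/2\rfloor}(-1)^k\frac{x^{\nu-2k}}{2^k\,k!\,(\nu-2k)!}$ (so $h_0=1$). For $x,y\in\mathbb{R}$ put $$k_j(x,y):=\sum_{\nu\in\mathbb{N}_0}\alpha_{\nu,j}^{-1}h_\nu(x)h_\nu(y),\qquad k_j^*:=k_j-\alpha_{0,j}^{-1},$$ which are well-defined under (i). Set $\prod_{j=1}^\infty a_j:=\lim_{J\to\infty}\prod_{j=1}^Ja_j$ whenever the limit exists in $\mathbb{R}$. The tensor product kernel is $K(\boldsymbol{x},\boldsymbol{y}):=\prod_{j=1}^\infty k_j(x_j,y_j)$; a set $\mathfrak{Y}\subseteq\mathbb{R}^{\mathbb{N}}$ is a domain for $K$ if the partial products $\prod_{j=1}^Jk_j(x_j,y_j)$ converge in $\mathbb{R}$ as $J\to\infty$ for all $\boldsymbol{x},\boldsymbol{y}\in\mathfrak{Y}$, and the maximal domain is the domain that contains every other domain. $\boldsymbol{U}$ is the set of all finite subsets of $\mathbb{N}$; for $\mathfrak{u}\in\boldsymbol{U}$, $$c_{\mathfrak{u}}:=\prod_{j\in\mathfrak{u}}\alpha_{0,j}\cdot\prod_{j=1}^\infty\alpha_{0,j}^{-1},\qquad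 k^*_{\mathfrak{u}}(\boldsymbol{x},\boldsymbol{y}):=\prod_{j\in\mathfrak{u}}k_j^*(x_j,y_j).$$ *)

theory Defs
  imports "HOL-Analysis.Infinite_Sum" "HOL-Library.FuncSet"
begin

text \<open>Throughout, the set of positive integers is \<open>{1..} :: nat set\<close>; values of \<open>\<alpha> \<nu> j\<close>
  at \<open>j = 0\<close> are irrelevant.\<close>

definition hermite_normalized :: "nat \<Rightarrow> real \<Rightarrow> real" where
  "hermite_normalized \<nu> x =
     sqrt (fact \<nu>) * (\<Sum>k=0..\<nu> div 2. (-1) ^ k * (x ^ (\<nu> - 2 * k) / (2 ^ k * fact k * fact (\<nu> - 2 * k))))"

definition kern :: "(nat \<Rightarrow> nat \<Rightarrow> real) \<Rightarrow> nat \<Rightarrow> real \<Rightarrow> real \<Rightarrow> real" where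
  "kern \<alpha> j x y = (\<Sum>\<^sub>\<infinity>\<nu>. inverse (\<alpha> \<nu> j) * hermite_normalized \<nu> x * hermite_normalized \<nu> y)"

definition kern_star :: "(nat \<Rightarrow> nat \<Rightarrow> real) \<Rightarrow> nat \<Rightarrow> real \<Rightarrow> real \<Rightarrow> real" where
  "kern_star \<alpha> j x y = kern \<alpha> j x y - inverse (\<alpha> 0 j)"

text \<open>Infinite products are plain limits of partial products; unlike with \<open>has_prod\<close>, partial
  products of nonzero factors tending to \<open>0\<close> count as convergent.\<close>

definition prod_converges :: "(nat \<Rightarrow> real) \<Rightarrow> bool" where
  "prod_converges a \<longleftrightarrow> convergent (\<lambda>J. \<Prod>j=1..J. a j)"

definition inf_prod :: "(nat \<Rightarrow> real) \<Rightarrow> real" where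
  "inf_prod a = lim (\<lambda>J. \<Prod>j=1..J. a j)"

definition real_seqs :: "(nat \<Rightarrow> real) set" where
  "real_seqs = ({1..} \<rightarrow>\<^sub>E UNIV)"

definition tensor_kernel :: "(nat \<Rightarrow> nat \<Rightarrow> real) \<Rightarrow> (nat \<Rightarrow> real) \<Rightarrow> (nat \<Rightarrow> real) \<Rightarrow> real" where
  "tensor_kernel \<alpha> x y = inf_prod (\<lambda>j. kern \<alpha> j (x j) (y j))"

definition is_domain :: "(nat \<Rightarrow> nat \<Rightarrow> real) \<Rightarrow> (nat \<Rightarrow> real) set \<Rightarrow> bool" where
  "is_domain \<alpha> Y \<longleftrightarrow>
     Y \<subseteq> real_seqs \<and> (\<forall>x\<in>Y. \<forall>y\<in>Y. prod_converges (\<lambda>j. kern \<alpha> j (x j) (y j)))"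

definition is_maximal_domain :: "(nat \<Rightarrow> nat \<Rightarrow> real) \<Rightarrow> (nat \<Rightarrow> real) set \<Rightarrow> bool" where
  "is_maximal_domain \<alpha> X \<longleftrightarrow> is_domain \<alpha> X \<and> (\<forall>Y. is_domain \<alpha> Y \<longrightarrow> Y \<subseteq> X)"

definition coeff_c :: "(nat \<Rightarrow> nat \<Rightarrow> real) \<Rightarrow> nat set \<Rightarrow> real" where
  "coeff_c \<alpha> u = (\<Prod>j\<in>u. \<alpha> 0 j) * inf_prod (\<lambda>j. inverse (\<alpha> 0 j))"

definition kern_star_set :: "(nat \<Rightarrow> nat \<Rightarrow> real) \<Rightarrow> nat set \<Rightarrow> (nat \<Rightarrow> real) \<Rightarrow> (nat \<Rightarrow> real) \<Rightarrow> real" where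
  "kern_star_set \<alpha> u x y = (\<Prod>j\<in>u. kern_star \<alpha> j (x j) (y j))"

text \<open>The diagonal values of \<^const>\<open>kern_star\<close> are sums of nonnegative terms when \<open>\<alpha>\<close> is positive
  (the \<open>\<nu> = 0\<close> term of \<^const>\<open>kern\<close> is \<open>inverse (\<alpha> 0 j)\<close>), so finiteness of the series
  is summability.\<close>

definition dom_X :: "(nat \<Rightarrow> nat \<Rightarrow> real) \<Rightarrow> (nat \<Rightarrow> real) set" where
  "dom_X \<alpha> = {x \<in> real_seqs. (\<lambda>j. kern_star \<alpha> j (x j) (x j)) summable_on {1..}}"

end

theory Submission
  imports Defs "HOL-Analysis.Infinite_Products"
begin

text \<open>Write \<open>k\<^sup>*\<close> for the kernel \<^const>\<open>kern_star\<close> and factor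
  \<open>k\<^sub>j = \<alpha>\<^sub>0\<^sub>,\<^sub>j\<inverse> (1 + b\<^sub>j)\<close> with \<open>b\<^sub>j = \<alpha>\<^sub>0\<^sub>,\<^sub>j k\<^sub>j\<^sup>*\<close>. Since \<open>\<alpha>\<^sub>0\<^sub>,\<^sub>j\<close> is a summable
  perturbation of \<open>1\<close>, the products of the \<open>\<alpha>\<^sub>0\<^sub>,\<^sub>j\<close> and of their inverses both converge, and the
  numbers \<open>\<alpha>\<^sub>0\<^sub>,\<^sub>j\<close> and their inverses are bounded. Hence neither the convergence of the products nor
  the summability of \<open>k\<^sub>j\<^sup>*\<close> is affected by these weights, and everything reduces to \<open>\<Prod>(1 + b\<^sub>j)\<close>.

  If \<open>\<Sum>\<bar>b\<^sub>j\<bar> < \<infinity>\<close>, expanding finite partial products gives \<open>\<Prod>\<^sub>j(1 + b\<^sub>j) = \<Sum>\<^sub>u \<Prod>\<^sub>j\<^sub>\<in>\<^sub>u b\<^sub>j\<close>, and the family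
  on the right is absolutely summable because its finite subsums are dominated by
  \<open>\<Prod>(1 + \<bar>b\<^sub>j\<bar>) \<le> exp(\<Sum>\<bar>b\<^sub>j\<bar>)\<close> (\<open>finite_products_abs_summable\<close>, \<open>prod_add_one_tendsto_infsum\<close>).
  For \<open>x\<close>, \<open>y\<close> in \<^term>\<open>dom_X \<alpha>\<close> this applies, because
  \<open>\<bar>k\<^sub>j\<^sup>*(x,y)\<bar> \<le> (k\<^sub>j\<^sup>*(x,x) + k\<^sub>j\<^sup>*(y,y))/2\<close> (\<open>abs_kern_star_le\<close>).
  Conversely, if \<open>x\<close> lies in some domain, then \<open>b\<^sub>j \<ge> 0\<close> on the diagonal, so that
  \<open>\<Sum>b\<^sub>j \<le> \<Prod>(1 + b\<^sub>j)\<close> and the convergent products bound the series (\<open>summable_if_prods_convergent\<close>).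

  What remains is that the series for \<open>k\<^sub>j\<close> converges on all of \<open>\<real> \<times> \<real>\<close>. Given the summability of
  \<open>\<alpha>\<^sub>\<nu>\<^sub>,\<^sub>j\<inverse> \<nu>\<^sup>-\<^sup>1\<^sup>/\<^sup>2\<close>, this is the pointwise bound \<open>h\<^sub>\<nu>(x)\<^sup>2 = O(\<nu>\<^sup>-\<^sup>1\<^sup>/\<^sup>2)\<close> (\<open>hermite_bound\<close>). It follows from
  Sonin's method: the Hermite function \<open>u(x) = exp(-x\<^sup>2/4) h\<^sub>n(x)\<close> solves \<open>u'' + (n + 1/2 - x\<^sup>2/4) u = 0\<close>,
  and its energy \<open>u'\<^sup>2 + (n + 1/2 - x\<^sup>2/4) u\<^sup>2\<close> has derivative \<open>- x u\<^sup>2 / 2\<close>, hence is maximal at \<open>0\<close>.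
  There the recurrence gives \<open>h\<^sub>n(0)\<^sup>2 \<le> (n + 1)\<^sup>-\<^sup>1\<^sup>/\<^sup>2\<close>, so the energy is \<open>O(n\<^sup>1\<^sup>/\<^sup>2)\<close>, and dividing by its
  potential term, which is of order \<open>n\<close>, yields the bound.\<close>

section \<open>Recurrence and derivatives of the normalized Hermite polynomials\<close>

text \<open>The summand is extended by \<open>0\<close> beyond \<open>n div 2\<close>, so that the sums for \<open>n\<close>, \<open>n + 1\<close> and
  \<open>n + 2\<close> can be compared over a common index range; the factor \<open>sqrt (fact n)\<close> is left out, which
  makes differentiation act termwise as \<open>n + 1 \<mapsto> n\<close>.\<close>

definition hermite_term :: "nat \<Rightarrow> nat \<Rightarrow> real \<Rightarrow> real" where
  "hermite_term n k x =
     (if 2 * k \<le> n then (-1) ^ k / (2 ^ k * fact k) * (x ^ (n - 2 * k) / fact (n - 2 * k)) else 0)"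

lemma hermite_normalized_eq_terms:
  "hermite_normalized n x = sqrt (fact n) * (\<Sum>k\<le>n. hermite_term n k x)"
proof -
  have "(\<Sum>k\<le>n. hermite_term n k x) = (\<Sum>k=0..n div 2. hermite_term n k x)"
    by (rule sum.mono_neutral_right) (auto simp: hermite_term_def)
  also have "\<dots> = (\<Sum>k=0..n div 2. (-1) ^ k * (x ^ (n - 2 * k) / (2 ^ k * fact k * fact (n - 2 * k))))"
    by (rule sum.cong) (auto simp: hermite_term_def power_divide)
  finally show ?thesis by (simp add: hermite_normalized_def)
qed

lemma monomial_Suc: "real (Suc m) * (x ^ Suc m / fact (Suc m)) = x * (x ^ m / fact m)" for x :: real
  unfolding fact_Suc power_Suc of_nat_mult of_nat_fact by (simp add: divide_simps del: of_nat_Suc)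

lemma hermite_term_recurrence_0:
  "real (Suc n) * hermite_term (Suc n) 0 x = x * hermite_term n 0 x"
  using monomial_Suc[of n x] by (simp add: hermite_term_def del: of_nat_Suc power_Suc fact_Suc)

text \<open>Termwise form of the recurrence, with a shift of \<open>k\<close> in the last summand: splitting the factor
  \<open>n + 2\<close> as \<open>(n - 2 k) + 2 (k + 1)\<close>, the first part lowers the power of \<open>x\<close> by one and the second
  part cancels against the factorial of \<open>k + 1\<close>.\<close>

lemma hermite_term_recurrence:
  "real (n + 2) * hermite_term (n + 2) (Suc k) x =
     x * hermite_term (n + 1) (Suc k) x - hermite_term n k x"
proof (cases "2 * k \<le> n")
  case True
  define m where "m = n - 2 * k"
  have n: "n = m + 2 * k" using True by (simp add: m_def)
  define a :: "nat \<Rightarrow> real" where "a i = (-1) ^ i / (2 ^ i * fact i)" for i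
  define b where "b i = x ^ i / fact i" for i
  have a: "2 * real (Suc k) * a (Suc k) = - a k"
    unfolding a_def fact_Suc power_Suc of_nat_mult of_nat_fact
    by (simp add: divide_simps del: of_nat_Suc)
  have t: "hermite_term (n + 2) (Suc k) x = a (Suc k) * b m" "hermite_term n k x = a k * b m"
    by (simp_all add: hermite_term_def a_def b_def n)
  have "real (n + 2) * (a (Suc k) * b m) = a (Suc k) * (real m * b m) + (2 * real (Suc k) * a (Suc k)) * b m"
    by (simp add: n algebra_simps)
  also have "\<dots> = a (Suc k) * (real m * b m) - a k * b m"
    by (simp only: a)
  also have "a (Suc k) * (real m * b m) = x * hermite_term (n + 1) (Suc k) x"
  proof (cases m)
    case 0
    then show ?thesis by (simp add: n hermite_term_def)
  next
    case (Suc l)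
    have "hermite_term (n + 1) (Suc k) x = a (Suc k) * b l"
      by (simp add: hermite_term_def a_def b_def n Suc)
    moreover have "real m * b m = x * b l"
      unfolding b_def Suc by (rule monomial_Suc)
    ultimately show ?thesis by simp
  qed
  finally show ?thesis by (simp only: t)
qed (auto simp: hermite_term_def)

lemma sqrt_fact_Suc: "sqrt (fact (Suc n)) = sqrt (real (Suc n)) * sqrt (fact n)"
  by (simp only: fact_Suc of_nat_mult real_sqrt_mult of_nat_fact)

lemma hermite_recurrence:
  "sqrt (real n + 2) * hermite_normalized (n + 2) x =
     x * hermite_normalized (n + 1) x - sqrt (real n + 1) * hermite_normalized n x"
proof -
  let ?S = "\<lambda>m. \<Sum>k\<le>m. hermite_term m k x"
  have ext1: "?S (n + 1) = hermite_term (n + 1) 0 x + (\<Sum>k\<le>Suc n. hermite_term (n + 1) (Suc k) x)"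
    by (subst sum.atMost_Suc_shift [symmetric]) (simp add: hermite_term_def)
  have ext0: "?S n = (\<Sum>k\<le>Suc n. hermite_term n k x)"
    by (simp add: hermite_term_def)
  have "real (n + 2) * ?S (n + 2) = real (n + 2) * hermite_term (n + 2) 0 x
      + (\<Sum>k\<le>Suc n. real (n + 2) * hermite_term (n + 2) (Suc k) x)"
    by (simp add: sum.atMost_Suc_shift sum_distrib_left distrib_left del: sum.atMost_Suc)
  also have "\<dots> = x * hermite_term (n + 1) 0 x
      + (\<Sum>k\<le>Suc n. x * hermite_term (n + 1) (Suc k) x - hermite_term n k x)"
    using hermite_term_recurrence_0[of "n + 1" x] 
    by (simp only: hermite_term_recurrence) simp
  also have "\<dots> = x * ?S (n + 1) - ?S n"
    unfolding ext1 ext0 by (simp only: sum_subtractf sum_distrib_left distrib_left add_diff_eq)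
  finally have S: "(real n + 2) * ?S (n + 2) = x * ?S (n + 1) - ?S n"
    by (simp only: of_nat_add of_nat_numeral)
  define a b where "a = sqrt (real n + 1)" and "b = sqrt (real n + 2)"
  have a: "a * a = real n + 1" and b: "b * b = real n + 2" by (auto simp: a_def b_def)
  have f1: "sqrt (fact (n + 1)) = a * sqrt (fact n)"
    using sqrt_fact_Suc[of n] by (simp add: a_def add.commute)
  have f2: "sqrt (fact (n + 2)) = b * (a * sqrt (fact n))"
    using sqrt_fact_Suc[of "n + 1"] f1 by (simp add: b_def add.commute)
  have "b * hermite_normalized (n + 2) x = a * sqrt (fact n) * ((b * b) * ?S (n + 2))"
    unfolding hermite_normalized_eq_terms f2 by (simp only: mult_ac)
  also have "\<dots> = a * sqrt (fact n) * (x * ?S (n + 1) - ?S n)"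
    by (simp only: b S)
  also have "\<dots> = x * hermite_normalized (n + 1) x - a * hermite_normalized n x"
    unfolding hermite_normalized_eq_terms f1 by (simp only: right_diff_distrib mult_ac)
  finally show ?thesis by (simp only: a_def b_def)
qed

lemma hermite_0 [simp]: "hermite_normalized 0 x = 1"
  by (simp add: hermite_normalized_def)

lemma hermite_1 [simp]: "hermite_normalized (Suc 0) x = x"
  by (simp add: hermite_normalized_def)

lemma DERIV_hermite_term:
  "((\<lambda>x. hermite_term (Suc n) k x) has_field_derivative hermite_term n k x) (at x)"
proof (cases "2 * k \<le> n")
  case True
  have D: "((\<lambda>x. c * (x ^ Suc m / fact (Suc m))) has_field_derivative c * (x ^ m / fact m)) (at x)"
    for c :: real and m
    unfolding fact_Suc of_nat_mult of_nat_fact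
    by (auto intro!: derivative_eq_intros simp: divide_simps simp del: of_nat_Suc power_Suc)
  from True have "Suc n - 2 * k = Suc (n - 2 * k)" by simp
  with True D[of _ "n - 2 * k"] show ?thesis
    unfolding hermite_term_def by (simp only: if_True le_SucI)
next
  case False
  then show ?thesis unfolding hermite_term_def
    by (cases "2 * k = Suc n") (auto intro!: derivative_eq_intros)
qed

lemma DERIV_hermite_Suc:
  "(hermite_normalized (Suc n) has_field_derivative
     sqrt (real n + 1) * hermite_normalized n x) (at x)"
proof -
  have "((\<lambda>x. sqrt (fact (Suc n)) * (\<Sum>k\<le>Suc n. hermite_term (Suc n) k x)) has_field_derivative
      sqrt (fact (Suc n)) * (\<Sum>k\<le>Suc n. hermite_term n k x)) (at x)"
    by (intro DERIV_cmult DERIV_sum DERIV_hermite_term)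
  moreover have "(\<Sum>k\<le>Suc n. hermite_term n k x) = (\<Sum>k\<le>n. hermite_term n k x)"
    by (simp add: hermite_term_def)
  moreover have "hermite_normalized (Suc n) =
      (\<lambda>x. sqrt (fact (Suc n)) * (\<Sum>k\<le>Suc n. hermite_term (Suc n) k x))"
    by (rule ext) (rule hermite_normalized_eq_terms)
  ultimately show ?thesis
    by (simp only: hermite_normalized_eq_terms sqrt_fact_Suc of_nat_Suc mult_ac add_ac)
qed

text \<open>Eliminating the polynomial of lower degree from the derivative rule by the recurrence gives the
  second first-order relation. Together with \<open>DERIV_hermite_Suc\<close> it is a first-order system for the
  pair of consecutive polynomials, equivalent to Hermite's differential equation, and it holds from
  \<open>n = 0\<close> on.\<close>

lemma DERIV_hermite:
  "(hermite_normalized n has_field_derivative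
     x * hermite_normalized n x - sqrt (real n + 1) * hermite_normalized (Suc n) x) (at x)"
proof (cases n)
  case 0
  have "hermite_normalized 0 = (\<lambda>x. 1)" by (rule ext) simp
  then show ?thesis by (simp add: 0)
next
  case (Suc m)
  then show ?thesis using DERIV_hermite_Suc[of m x] hermite_recurrence[of m x]
    by (simp add: add.commute)
qed

section \<open>The pointwise bound on Hermite polynomials\<close>

text \<open>At \<open>0\<close> the recurrence reads \<open>(n + 2) h\<^sub>n\<^sub>+\<^sub>2\<^sup>2 = (n + 1) h\<^sub>n\<^sup>2\<close>. The quantity \<open>h\<^sub>n\<^sup>4 (n + 1)\<close> is the one
  that passes through the induction, as \<open>(n + 1) (n + 3) \<le> (n + 2)\<^sup>2\<close>.\<close>

lemma hermite_at_0_bound: "(hermite_normalized n 0)\<^sup>2 \<le> 1 / sqrt (real n + 1)"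
proof -
  have "((hermite_normalized n 0)\<^sup>2)\<^sup>2 * (real n + 1) \<le> 1"
  proof (induction n rule: induct_nat_012)
    case (ge2 n)
    let ?w = "\<lambda>n. (hermite_normalized n 0)\<^sup>2"
    have "(sqrt (real n + 2) * hermite_normalized (n + 2) 0)\<^sup>2 = (sqrt (real n + 1) * hermite_normalized n 0)\<^sup>2"
      by (simp only: hermite_recurrence) simp
    then have "(real n + 2) * ?w (n + 2) = (real n + 1) * ?w n"
      by (simp add: power_mult_distrib)
    then have w: "?w (n + 2) = (real n + 1) * ?w n / (real n + 2)"
      by (simp add: field_simps)
    have "(?w (n + 2))\<^sup>2 * (real n + 3) =
        ((?w n)\<^sup>2 * (real n + 1)) * ((real n + 1) * (real n + 3) / (real n + 2)\<^sup>2)"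
      unfolding w by (simp add: power2_eq_square)
    also have "\<dots> \<le> 1 * 1"
    proof (rule mult_mono)
      have "(real n + 1) * (real n + 3) \<le> (real n + 2)\<^sup>2"
        by (simp add: power2_eq_square algebra_simps)
      then show "(real n + 1) * (real n + 3) / (real n + 2)\<^sup>2 \<le> 1" by simp
    qed (use ge2 in auto)
    finally show ?case by (simp add: add.commute)
  qed simp_all
  then have "((hermite_normalized n 0)\<^sup>2)\<^sup>2 \<le> (1 / sqrt (real n + 1))\<^sup>2"
    by (simp add: field_simps)
  then show ?thesis by (rule power2_le_imp_le) simp
qed

text \<open>This is \<open>u'\<^sup>2 + (n + 3/2 - x\<^sup>2/4) u\<^sup>2\<close> for the Hermite function \<open>u(x) = exp(-x\<^sup>2/4) h\<^sub>n\<^sub>+\<^sub>1(x)\<close>, with the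
  square expanded and the derivative of \<open>h\<^sub>n\<^sub>+\<^sub>1\<close> replaced by \<open>sqrt (n + 1) h\<^sub>n\<close>.\<close>

definition hermite_energy :: "nat \<Rightarrow> real \<Rightarrow> real" where
  "hermite_energy n x = exp (- x\<^sup>2 / 2) *
     ((real n + 1) * (hermite_normalized n x)\<^sup>2
      - x * sqrt (real n + 1) * hermite_normalized (Suc n) x * hermite_normalized n x
      + (real n + 3/2) * (hermite_normalized (Suc n) x)\<^sup>2)"

lemma DERIV_hermite_energy:
  "(hermite_energy n has_field_derivative
     - x / 2 * (exp (- x\<^sup>2 / 2) * (hermite_normalized (Suc n) x)\<^sup>2)) (at x)"
proof -
  define s where "s = sqrt (real n + 1)"
  have s: "real n + 1 = s * s" "real n + 3/2 = s * s + 1/2" by (simp_all add: s_def)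
  have D: "(hermite_normalized n has_field_derivative
      x * hermite_normalized n x - s * hermite_normalized (Suc n) x) (at x)"
    "(hermite_normalized (Suc n) has_field_derivative s * hermite_normalized n x) (at x)"
    unfolding s_def by (rule DERIV_hermite DERIV_hermite_Suc)+
  show ?thesis
    unfolding hermite_energy_def [abs_def] s_def [symmetric] unfolding s
    by (rule derivative_eq_intros D refl | simp)+ (simp add: field_simps power2_eq_square)
qed

lemma hermite_energy_le: "hermite_energy n x \<le> hermite_energy n 0"
proof (cases "0 \<le> x")
  case True
  then show ?thesis
    by (rule DERIV_nonpos_imp_nonincreasing) (use DERIV_hermite_energy in fastforce)
next
  case False
  then have "x \<le> 0" by simp
  then show ?thesis
    by (rule DERIV_nonneg_imp_nondecreasing) (use DERIV_hermite_energy in \<open>fastforce simp: mult_nonpos_nonneg\<close>)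
qed

text \<open>The condition \<open>x\<^sup>2 \<le> n\<close> keeps \<open>x\<close> inside the oscillatory region: there the potential
  \<open>n + 1/2 - x\<^sup>2/4\<close> is at least \<open>3 n / 4\<close>, so the energy controls \<open>h\<^sub>n(x)\<^sup>2\<close>. The energy at \<open>0\<close> is at most
  \<open>3 sqrt n\<close>, and the quotient of the two constants is the factor \<open>4\<close>.\<close>

lemma hermite_bound:
  assumes n: "n \<ge> 1" and x: "x\<^sup>2 \<le> real n"
  shows "(hermite_normalized n x)\<^sup>2 \<le> 4 * exp (x\<^sup>2 / 2) * real n powr (-1/2)"
proof -
  obtain m where m: "n = Suc m" using n by (cases n) auto
  define s where "s = sqrt (real n)"
  have s: "s * s = real n" "s > 0" using n by (simp_all add: s_def)
  let ?h = "hermite_normalized n x" and ?g = "hermite_normalized m x"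
  have nm: "real m + 1 = s * s" "real m + 3/2 = s * s + 1/2" "sqrt (real m + 1) = s"
    using s by (simp_all add: m s_def add.commute)
  have lower: "exp (- x\<^sup>2 / 2) * (3/4 * (s * s) * ?h\<^sup>2) \<le> hermite_energy m x"
  proof -
    have "3/4 * (s * s) * ?h\<^sup>2 \<le> (s * s + 1/2 - x\<^sup>2 / 4) * ?h\<^sup>2"
      using x s by (intro mult_right_mono) auto
    \<comment> \<open>The added square is the kinetic term of the energy.\<close>
    also have "\<dots> \<le> (s * ?g - x / 2 * ?h)\<^sup>2 + (s * s + 1/2 - x\<^sup>2 / 4) * ?h\<^sup>2" by simp
    also have "\<dots> = s * s * ?g\<^sup>2 - x * s * ?h * ?g + (s * s + 1/2) * ?h\<^sup>2"
      by (simp add: power2_eq_square algebra_simps)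
    finally show ?thesis unfolding hermite_energy_def nm(3) unfolding nm m[symmetric]
      by (rule mult_left_mono) simp
  qed
  have upper: "hermite_energy m 0 \<le> 3 * s"
  proof -
    have inv: "s * (1 / s) = 1" using s by simp
    have "s * s * (hermite_normalized m 0)\<^sup>2 \<le> s * s * (1 / s)"
      using hermite_at_0_bound[of m] nm by (intro mult_left_mono) auto
    also have "\<dots> = s" by (simp only: mult.assoc inv mult_1_right)
    finally have g0: "s * s * (hermite_normalized m 0)\<^sup>2 \<le> s" .
    have "(s * s + 1/2) * (hermite_normalized n 0)\<^sup>2 \<le> (2 * s * s) * (1 / s)"
    proof (rule mult_mono)
      show "s * s + 1/2 \<le> 2 * s * s" using n s by simp
      have "s \<le> sqrt (real n + 1)" by (simp add: s_def)
      then have "1 / sqrt (real n + 1) \<le> 1 / s" using s by (simp add: frac_le)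
      then show "(hermite_normalized n 0)\<^sup>2 \<le> 1 / s"
        using hermite_at_0_bound[of n] by simp
    qed (use s in auto)
    also have "\<dots> = 2 * s" by (simp only: mult.assoc inv mult_1_right)
    finally have h0: "(s * s + 1/2) * (hermite_normalized n 0)\<^sup>2 \<le> 2 * s" .
    have "hermite_energy m 0 = s * s * (hermite_normalized m 0)\<^sup>2 + (s * s + 1/2) * (hermite_normalized n 0)\<^sup>2"
      by (simp add: hermite_energy_def nm m[symmetric])
    with g0 h0 show ?thesis by linarith
  qed
  have "3/4 * (s * s) * (exp (- x\<^sup>2 / 2) * ?h\<^sup>2) \<le> 3 * s"
    using lower hermite_energy_le[of m x] upper by (simp add: mult_ac)
  then have "exp (- x\<^sup>2 / 2) * ?h\<^sup>2 \<le> 4 / s" using s(2) by (simp add: field_simps)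
  then have "exp (x\<^sup>2 / 2) * (exp (- x\<^sup>2 / 2) * ?h\<^sup>2) \<le> exp (x\<^sup>2 / 2) * (4 / s)"
    by (rule mult_left_mono) simp
  moreover have "exp (x\<^sup>2 / 2) * exp (- x\<^sup>2 / 2) = 1" by (simp add: exp_minus)
  moreover have "real n powr (-1/2) = 1 / s"
    using n by (simp add: s_def powr_minus_divide powr_half_sqrt)
  ultimately show ?thesis by (simp add: mult.assoc[symmetric] mult.commute[of _ 4])
qed

section \<open>The series of the univariate kernels\<close>

text \<open>The pointwise bound holds from an index depending on \<open>x\<close> on; the finitely many earlier terms do
  not matter.\<close>

lemma hermite_square_series_summable:
  fixes a :: "nat \<Rightarrow> real"
  assumes a: "\<And>\<nu>. \<nu> \<ge> 1 \<Longrightarrow> a \<nu> \<ge> 0"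
    and sum: "(\<lambda>\<nu>. a \<nu> * real \<nu> powr (-1/2)) summable_on {1..}"
  shows "(\<lambda>\<nu>. a \<nu> * (hermite_normalized \<nu> x)\<^sup>2) summable_on {1..}"
proof -
  obtain N where N: "x\<^sup>2 \<le> real N" using real_arch_simple by blast
  let ?f = "\<lambda>\<nu>. a \<nu> * (hermite_normalized \<nu> x)\<^sup>2"
  have "(\<lambda>\<nu>. (4 * exp (x\<^sup>2 / 2)) * (a \<nu> * real \<nu> powr (-1/2))) summable_on {max 1 N..}"
    by (intro summable_on_cmult_right summable_on_subset_banach[OF sum]) auto
  then have "?f summable_on {max 1 N..}"
  proof (rule summable_on_comparison_test)
    fix \<nu> assume \<nu>: "\<nu> \<in> {max 1 N..}"
    then have "a \<nu> * (hermite_normalized \<nu> x)\<^sup>2 \<le> a \<nu> * (4 * exp (x\<^sup>2 / 2) * real \<nu> powr (-1/2))"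
      using N a by (intro mult_left_mono hermite_bound) auto
    then show "?f \<nu> \<le> 4 * exp (x\<^sup>2 / 2) * (a \<nu> * real \<nu> powr (-1/2))" by (simp only: mult_ac)
  qed (use a in auto)
  moreover have "?f summable_on {1..<max 1 N}" by (rule summable_on_finite) simp
  ultimately have "?f summable_on ({1..<max 1 N} \<union> {max 1 N..})"
    by (intro summable_on_Un_disjoint) auto
  moreover have "{1..<max 1 N} \<union> {max 1 N..} = {1..}" by auto
  ultimately show ?thesis by simp
qed

lemma weighted_mult_le_squares:
  fixes a u v :: real
  assumes "a \<ge> 0"
  shows "\<bar>a * u * v\<bar> \<le> 1/2 * (a * u\<^sup>2 + a * v\<^sup>2)"
proof -
  have "0 \<le> (\<bar>u\<bar> - \<bar>v\<bar>)\<^sup>2" by simp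
  then have "\<bar>u\<bar> * \<bar>v\<bar> \<le> 1/2 * (u\<^sup>2 + v\<^sup>2)" by (simp add: power2_diff)
  then have "a * (\<bar>u\<bar> * \<bar>v\<bar>) \<le> a * (1/2 * (u\<^sup>2 + v\<^sup>2))" using assms by (rule mult_left_mono)
  then show ?thesis using assms by (simp add: abs_mult algebra_simps)
qed

locale kernel_weights =
  fixes \<alpha> :: "nat \<Rightarrow> nat \<Rightarrow> real" and j :: nat
  assumes pos: "\<And>\<nu>. \<alpha> \<nu> j > 0"
    and weights_summable: "(\<lambda>\<nu>. inverse (\<alpha> \<nu> j) * real \<nu> powr (-1/2)) summable_on {1..}"
begin

lemma diagonal_summable: "(\<lambda>\<nu>. inverse (\<alpha> \<nu> j) * (hermite_normalized \<nu> x)\<^sup>2) summable_on {1..}"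
  by (rule hermite_square_series_summable) (use pos weights_summable in \<open>auto simp: less_imp_le\<close>)

lemma term_le:
  "\<bar>inverse (\<alpha> \<nu> j) * hermite_normalized \<nu> x * hermite_normalized \<nu> y\<bar> \<le>
     1/2 * (inverse (\<alpha> \<nu> j) * (hermite_normalized \<nu> x)\<^sup>2 + inverse (\<alpha> \<nu> j) * (hermite_normalized \<nu> y)\<^sup>2)"
  by (rule weighted_mult_le_squares) (use pos[of \<nu>] in simp)

lemma kernel_series_abs_summable:
  "(\<lambda>\<nu>. inverse (\<alpha> \<nu> j) * hermite_normalized \<nu> x * hermite_normalized \<nu> y) abs_summable_on {1..}"
proof (rule abs_summable_on_comparison_test')
  show "(\<lambda>\<nu>. 1/2 * (inverse (\<alpha> \<nu> j) * (hermite_normalized \<nu> x)\<^sup>2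
      + inverse (\<alpha> \<nu> j) * (hermite_normalized \<nu> y)\<^sup>2)) summable_on {1..}"
    by (intro summable_on_cmult_right summable_on_add diagonal_summable)
qed (use term_le in simp)

lemma kern_star_eq_series:
  "kern_star \<alpha> j x y =
     (\<Sum>\<^sub>\<infinity>\<nu>\<in>{1..}. inverse (\<alpha> \<nu> j) * hermite_normalized \<nu> x * hermite_normalized \<nu> y)"
proof -
  let ?t = "\<lambda>\<nu>. inverse (\<alpha> \<nu> j) * hermite_normalized \<nu> x * hermite_normalized \<nu> y"
  have "kern \<alpha> j x y = infsum ?t (insert 0 {1..})"
    unfolding kern_def by (rule arg_cong[where f = "infsum ?t"]) auto
  also have "\<dots> = ?t 0 + infsum ?t {1..}"
    by (rule infsum_insert) (rule abs_summable_summable[OF kernel_series_abs_summable], simp)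
  finally show ?thesis by (simp add: kern_star_def)
qed

lemma kern_star_diagonal:
  "kern_star \<alpha> j x x = (\<Sum>\<^sub>\<infinity>\<nu>\<in>{1..}. inverse (\<alpha> \<nu> j) * (hermite_normalized \<nu> x)\<^sup>2)"
  by (simp add: kern_star_eq_series power2_eq_square mult.assoc)

lemma kern_star_diagonal_nonneg: "kern_star \<alpha> j x x \<ge> 0"
  unfolding kern_star_diagonal by (rule infsum_nonneg) (use pos in \<open>simp add: less_imp_le\<close>)

text \<open>This takes the place of the Cauchy-Schwarz inequality for the positive semidefinite kernel; the
  arithmetic mean is what is needed, as summability of the two diagonals is additive.\<close>

lemma abs_kern_star_le: "\<bar>kern_star \<alpha> j x y\<bar> \<le> 1/2 * (kern_star \<alpha> j x x + kern_star \<alpha> j y y)"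
proof -
  let ?t = "\<lambda>\<nu>. inverse (\<alpha> \<nu> j) * hermite_normalized \<nu> x * hermite_normalized \<nu> y"
  let ?d = "\<lambda>x \<nu>. inverse (\<alpha> \<nu> j) * (hermite_normalized \<nu> x)\<^sup>2"
  have "\<bar>kern_star \<alpha> j x y\<bar> \<le> (\<Sum>\<^sub>\<infinity>\<nu>\<in>{1..}. norm (?t \<nu>))"
    unfolding kern_star_eq_series
    using norm_infsum_bound[OF kernel_series_abs_summable] by simp
  also have "\<dots> \<le> (\<Sum>\<^sub>\<infinity>\<nu>\<in>{1..}. 1/2 * (?d x \<nu> + ?d y \<nu>))"
    by (intro infsum_mono kernel_series_abs_summable summable_on_cmult_right summable_on_add
        diagonal_summable) (use term_le in simp)
  also have "\<dots> = 1/2 * (kern_star \<alpha> j x x + kern_star \<alpha> j y y)"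
    unfolding kern_star_diagonal
    by (subst infsum_cmult_right, intro summable_on_add diagonal_summable)
       (subst infsum_add, (rule diagonal_summable refl)+)
  finally show ?thesis .
qed

end

section \<open>Expansion of infinite products over finite subsets\<close>

lemma prod_add_one_eq_sum_Pow:
  fixes b :: "'a \<Rightarrow> 'b :: comm_semiring_1"
  assumes "finite F"
  shows "(\<Prod>j\<in>F. 1 + b j) = (\<Sum>u\<in>Pow F. \<Prod>j\<in>u. b j)"
  using prod_add[OF assms, of b "\<lambda>_. 1"] by (simp add: add.commute)

text \<open>Any finite collection of finite subsets of \<open>A\<close> is contained in the power set of its union \<open>U\<close>,
  and over \<open>Pow U\<close> the absolute values sum to \<open>\<Prod>\<^sub>j\<^sub>\<in>\<^sub>U (1 + \<bar>b j\<bar>) \<le> exp (\<Sum>\<^sub>j\<^sub>\<in>\<^sub>A \<bar>b j\<bar>)\<close>.\<close>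

lemma finite_products_abs_summable:
  fixes b :: "'a \<Rightarrow> real"
  assumes b: "b abs_summable_on A"
  shows "(\<lambda>u. \<Prod>j\<in>u. b j) abs_summable_on Fpow A"
proof (rule nonneg_bdd_above_summable_on)
  show "bdd_above (sum (\<lambda>u. norm (\<Prod>j\<in>u. b j)) ` {F. F \<subseteq> Fpow A \<and> finite F})"
  proof (rule bdd_aboveI2)
    fix F assume "F \<in> {F. F \<subseteq> Fpow A \<and> finite F}"
    then have F: "F \<subseteq> Fpow A" "finite F" by auto
    define U where "U = \<Union>F"
    have U: "finite U" "U \<subseteq> A" "F \<subseteq> Pow U"
      using F by (auto simp: U_def Fpow_def)
    have "(\<Sum>u\<in>F. norm (\<Prod>j\<in>u. b j)) \<le> (\<Sum>u\<in>Pow U. norm (\<Prod>j\<in>u. b j))"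
      using U by (intro sum_mono2) auto
    also have "\<dots> = (\<Prod>j\<in>U. 1 + norm (b j))"
      using U by (simp add: prod_add_one_eq_sum_Pow abs_prod)
    also have "\<dots> \<le> exp (\<Sum>j\<in>U. norm (b j))"
      by (rule prod_le_exp_sum) simp
    also have "\<dots> \<le> exp (\<Sum>\<^sub>\<infinity>j\<in>A. norm (b j))"
      using finite_sum_le_infsum[OF b U(1,2)] by simp
    finally show "(\<Sum>u\<in>F. norm (\<Prod>j\<in>u. b j)) \<le> exp (\<Sum>\<^sub>\<infinity>j\<in>A. norm (b j))" .
  qed
qed simp

text \<open>Power sets of finite subsets are cofinal among the finite collections of finite subsets, so an
  unconditional sum over \<^term>\<open>Fpow A\<close> can be evaluated along them, where it is a finite product.\<close>

lemma filterlim_Pow_finite_subsets_at_top: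
  "filterlim Pow (finite_subsets_at_top (Fpow A)) (finite_subsets_at_top A)"
  unfolding filterlim_finite_subsets_at_top
proof (intro allI impI)
  fix X assume X: "finite X \<and> X \<subseteq> Fpow A"
  then have U: "finite (\<Union>X)" "\<Union>X \<subseteq> A" by (auto simp: Fpow_def)
  have "finite (Pow F) \<and> X \<subseteq> Pow F \<and> Pow F \<subseteq> Fpow A"
    if F: "finite F" "\<Union>X \<subseteq> F" "F \<subseteq> A" for F
  proof (intro conjI subsetI)
    fix u assume "u \<in> Pow F"
    then show "u \<in> Fpow A" using F(1,3) finite_subset[of u F] by (simp add: Fpow_def)
  qed (use F in auto)
  with U show "\<forall>\<^sub>F F in finite_subsets_at_top A. finite (Pow F) \<and> X \<subseteq> Pow F \<and> Pow F \<subseteq> Fpow A"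
    unfolding eventually_finite_subsets_at_top by (intro exI[of _ "\<Union>X"]) simp
qed

lemma prod_add_one_tendsto_infsum:
  fixes b :: "'a \<Rightarrow> real"
  assumes "b abs_summable_on A"
  shows "((\<lambda>F. \<Prod>j\<in>F. 1 + b j) \<longlongrightarrow> (\<Sum>\<^sub>\<infinity>u\<in>Fpow A. \<Prod>j\<in>u. b j)) (finite_subsets_at_top A)"
proof -
  have "((\<lambda>F. \<Sum>u\<in>Pow F. \<Prod>j\<in>u. b j) \<longlongrightarrow> (\<Sum>\<^sub>\<infinity>u\<in>Fpow A. \<Prod>j\<in>u. b j)) (finite_subsets_at_top A)"
    by (rule filterlim_compose[OF infsum_tendsto filterlim_Pow_finite_subsets_at_top])
       (rule abs_summable_summable[OF finite_products_abs_summable[OF assms]])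
  then show ?thesis
    by (rule Lim_transform_eventually)
       (simp add: prod_add_one_eq_sum_Pow eventually_finite_subsets_at_top_weakI)
qed

lemma finite_subset_initial_segment:
  assumes "finite X" "X \<subseteq> {1::nat..}"
  obtains n where "X \<subseteq> {1..n}"
proof -
  obtain n where "X \<subseteq> {..n}" using assms(1) by (auto simp: finite_nat_set_iff_bounded_le)
  with assms(2) have "X \<subseteq> {1..n}" unfolding atLeastAtMost_def by (rule Int_greatest)
  then show thesis by (rule that)
qed

lemma filterlim_initial_segments:
  "filterlim (\<lambda>J. {1..J}) (finite_subsets_at_top {1::nat..}) sequentially"
  unfolding filterlim_finite_subsets_at_top
proof (intro allI impI)
  fix X :: "nat set" assume "finite X \<and> X \<subseteq> {1..}"
  then obtain n where n: "X \<subseteq> {1..n}" using finite_subset_initial_segment by blast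
  have "finite {1..J} \<and> X \<subseteq> {1..J} \<and> {1..J} \<subseteq> {1..}" if "n \<le> J" for J
    using order.trans[OF n, of "{1..J}"] that by simp
  then show "\<forall>\<^sub>F J in sequentially. finite {1..J} \<and> X \<subseteq> {1..J} \<and> {1..J} \<subseteq> {1..}"
    by (rule eventually_sequentiallyI)
qed

lemma prod_add_one_LIMSEQ:
  fixes b :: "nat \<Rightarrow> real"
  assumes "b abs_summable_on {1..}"
  shows "(\<lambda>J. \<Prod>j=1..J. 1 + b j) \<longlonglongrightarrow> (\<Sum>\<^sub>\<infinity>u\<in>Fpow {1..}. \<Prod>j\<in>u. b j)"
  by (rule filterlim_compose[OF prod_add_one_tendsto_infsum[OF assms] filterlim_initial_segments])

text \<open>The converse direction, which gives maximality of the domain: for nonnegative \<open>b\<close> the products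
  dominate the sums.\<close>

lemma summable_if_prods_convergent:
  fixes b :: "nat \<Rightarrow> real"
  assumes b: "\<And>j. j \<ge> 1 \<Longrightarrow> b j \<ge> 0"
    and conv: "convergent (\<lambda>J. \<Prod>j=1..J. 1 + b j)"
  shows "b summable_on {1..}"
proof -
  obtain M where M: "\<And>J. \<bar>\<Prod>j=1..J. 1 + b j\<bar> \<le> M"
    using convergent_imp_Bseq[OF conv] by (auto simp: Bseq_def)
  show ?thesis
  proof (rule nonneg_bdd_above_summable_on)
    show "bdd_above (sum b ` {F. F \<subseteq> {1..} \<and> finite F})"
    proof (rule bdd_aboveI2)
      fix F assume "F \<in> {F. F \<subseteq> {1::nat..} \<and> finite F}"
      then have F: "F \<subseteq> {1..}" "finite F" by auto
      obtain J where "F \<subseteq> {1..J}" using finite_subset_initial_segment[OF F(2,1)] .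
      then have "sum b F \<le> sum b {1..J}" using b by (intro sum_mono2) auto
      also have "\<dots> \<le> (\<Prod>j=1..J. 1 + b j)" by (rule sum_le_prod) (use b in auto)
      also have "\<dots> \<le> M" using M[of J] by simp
      finally show "sum b F \<le> M" .
    qed
  qed (use b in auto)
qed

section \<open>Products of weights that are summably close to one\<close>

lemma bounded_away_from_0_and_infinity:
  fixes c :: "nat \<Rightarrow> real"
  assumes c: "\<And>j. j \<ge> 1 \<Longrightarrow> c j > 0" and sum: "(\<lambda>j. \<bar>c j - 1\<bar>) summable_on {1..}"
  obtains C where "C > 0" "\<And>j. j \<ge> 1 \<Longrightarrow> c j \<le> C" "\<And>j. j \<ge> 1 \<Longrightarrow> inverse (c j) \<le> C"
proof -
  have "{1..} = range Suc" by (metis One_nat_def atLeast_Suc_greaterThan greaterThan_0)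
  then have "(\<lambda>j. \<bar>c (Suc j) - 1\<bar>) summable_on UNIV"
    using sum by (simp add: summable_on_reindex o_def)
  then have "(\<lambda>j. \<bar>c (Suc j) - 1\<bar>) \<longlonglongrightarrow> 0"
    by (intro summable_LIMSEQ_zero summable_on_imp_summable)
  then have lim: "(\<lambda>j. c (Suc j)) \<longlonglongrightarrow> 1"
    by (simp add: tendsto_rabs_zero_iff LIM_zero_iff)
  then have "(\<lambda>j. inverse (c (Suc j))) \<longlonglongrightarrow> inverse 1"
    by (rule tendsto_inverse) simp
  then have "Bseq (\<lambda>j. inverse (c (Suc j)))"
    by (rule convergent_imp_Bseq[OF convergentI])
  moreover have "Bseq (\<lambda>j. c (Suc j))"
    using lim by (rule convergent_imp_Bseq[OF convergentI])
  ultimately obtain B D where B: "\<And>j. \<bar>c (Suc j)\<bar> \<le> B" and D: "\<And>j. \<bar>inverse (c (Suc j))\<bar> \<le> D"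
    unfolding Bseq_def real_norm_def by blast
  show thesis
  proof (rule that[of "max 1 (max B D)"])
    fix j :: nat assume "j \<ge> 1"
    then obtain i where i: "j = Suc i" by (cases j) auto
    show "c j \<le> max 1 (max B D)" "inverse (c j) \<le> max 1 (max B D)"
      using abs_le_D1[OF B[of i]] abs_le_D1[OF D[of i]] by (simp_all only: i max.coboundedI2 max.coboundedI1)
  qed simp
qed

lemma partial_prods_convergent:
  fixes c :: "nat \<Rightarrow> real"
  assumes "(\<lambda>j. \<bar>c j - 1\<bar>) summable_on {1..}"
  shows "convergent (\<lambda>J. \<Prod>j=1..J. c j)"
  using prod_add_one_LIMSEQ[of "\<lambda>j. c j - 1"] assms by (auto simp: convergent_def)

text \<open>The inverses are again a summable perturbation of \<open>1\<close>, because \<open>1/c - 1 = - (c - 1)/c\<close> and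
  \<open>1/c\<close> is bounded.\<close>

lemma inverse_partial_prods_convergent:
  fixes c :: "nat \<Rightarrow> real"
  assumes c: "\<And>j. j \<ge> 1 \<Longrightarrow> c j > 0" and sum: "(\<lambda>j. \<bar>c j - 1\<bar>) summable_on {1..}"
  shows "convergent (\<lambda>J. \<Prod>j=1..J. inverse (c j))"
proof -
  obtain C where C: "\<And>j. j \<ge> 1 \<Longrightarrow> inverse (c j) \<le> C"
    using bounded_away_from_0_and_infinity[OF c sum] by blast
  have "(\<lambda>j. \<bar>inverse (c j) - 1\<bar>) summable_on {1..}"
  proof (rule summable_on_comparison_test)
    show "(\<lambda>j. C * \<bar>c j - 1\<bar>) summable_on {1..}" by (rule summable_on_cmult_right[OF sum])
    fix j :: nat assume "j \<in> {1..}"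
    then have j: "c j > 0" "inverse (c j) \<le> C" using c C by auto
    then have "inverse (c j) - 1 = - (inverse (c j) * (c j - 1))"
      by (simp add: algebra_simps)
    then have "\<bar>inverse (c j) - 1\<bar> = inverse (c j) * \<bar>c j - 1\<bar>"
      using j by (simp add: abs_mult)
    then show "\<bar>inverse (c j) - 1\<bar> \<le> C * \<bar>c j - 1\<bar>"
      using j by (simp add: mult_right_mono)
  qed simp
  then show ?thesis by (rule partial_prods_convergent)
qed

section \<open>The maximal domain of the tensor product kernel\<close>

theorem lemma3p8:
  fixes \<alpha> :: "nat \<Rightarrow> nat \<Rightarrow> real"
  assumes pos: "\<And>\<nu> j. j \<ge> 1 \<Longrightarrow> \<alpha> \<nu> j > 0"
    and i_sum: "\<And>j. j \<ge> 1 \<Longrightarrow> (\<lambda>\<nu>. inverse (\<alpha> \<nu> j) * real \<nu> powr (-1/2)) summable_on {1..}"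
    and i_mono: "\<And>\<nu> j. \<nu> \<ge> 1 \<Longrightarrow> j \<ge> 1 \<Longrightarrow> \<alpha> \<nu> j \<le> \<alpha> (\<nu> + 1) j"
    and ii: "(\<lambda>j. \<bar>\<alpha> 0 j - 1\<bar>) summable_on {1..}"
  shows "is_maximal_domain \<alpha> (dom_X \<alpha>) \<and>
    (\<forall>x\<in>dom_X \<alpha>. \<forall>y\<in>dom_X \<alpha>.
       (\<lambda>u. coeff_c \<alpha> u * kern_star_set \<alpha> u x y) abs_summable_on Fpow {1..} \<and>
       tensor_kernel \<alpha> x y = (\<Sum>\<^sub>\<infinity>u\<in>Fpow {1..}. coeff_c \<alpha> u * kern_star_set \<alpha> u x y))"
proof -
  have weights: "kernel_weights \<alpha> j" if "j \<ge> 1" for j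
    by (rule kernel_weights.intro) (use that pos i_sum in auto)
  obtain C where C: "C > 0" "\<And>j. j \<ge> 1 \<Longrightarrow> \<alpha> 0 j \<le> C" "\<And>j. j \<ge> 1 \<Longrightarrow> inverse (\<alpha> 0 j) \<le> C"
    using bounded_away_from_0_and_infinity[of "\<alpha> 0"] pos ii by blast
  define b where "b x y j = \<alpha> 0 j * kern_star \<alpha> j (x j) (y j)" for x y j
  define a where "a = inf_prod (\<lambda>j. inverse (\<alpha> 0 j))"
  have a: "(\<lambda>J. \<Prod>j=1..J. inverse (\<alpha> 0 j)) \<longlonglongrightarrow> a"
    using inverse_partial_prods_convergent[of "\<alpha> 0"] pos ii
    unfolding a_def inf_prod_def by (simp add: convergent_LIMSEQ_iff)
  have kern_eq: "kern \<alpha> j (x j) (y j) = inverse (\<alpha> 0 j) * (1 + b x y j)" if "j \<ge> 1" for x y j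
    using pos[of j 0] that by (simp add: b_def kern_star_def field_simps)
  have prod_kern: "(\<Prod>j=1..J. kern \<alpha> j (x j) (y j)) =
      (\<Prod>j=1..J. inverse (\<alpha> 0 j)) * (\<Prod>j=1..J. 1 + b x y j)" for x y J
    unfolding prod.distrib[symmetric] by (rule prod.cong) (auto simp: kern_eq)

  have b_summable: "b x y abs_summable_on {1..}" if x: "x \<in> dom_X \<alpha>" and y: "y \<in> dom_X \<alpha>" for x y
  proof (rule abs_summable_on_comparison_test')
    show "(\<lambda>j. C * (1/2 * (kern_star \<alpha> j (x j) (x j) + kern_star \<alpha> j (y j) (y j)))) summable_on {1..}"
      using x y by (intro summable_on_cmult_right summable_on_add) (auto simp: dom_X_def)
    fix j :: nat assume "j \<in> {1..}"
    then have j: "j \<ge> 1" by simp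
    have "\<bar>b x y j\<bar> = \<alpha> 0 j * \<bar>kern_star \<alpha> j (x j) (y j)\<bar>"
      using pos[OF j, of 0] by (simp add: b_def abs_mult)
    also have "\<dots> \<le> C * (1/2 * (kern_star \<alpha> j (x j) (x j) + kern_star \<alpha> j (y j) (y j)))"
      using kernel_weights.abs_kern_star_le[OF weights[OF j]] C j by (intro mult_mono) auto
    finally show "norm (b x y j) \<le> \<dots>" by simp
  qed
  have K_lim: "(\<lambda>J. \<Prod>j=1..J. kern \<alpha> j (x j) (y j)) \<longlonglongrightarrow> a * (\<Sum>\<^sub>\<infinity>u\<in>Fpow {1..}. \<Prod>j\<in>u. b x y j)"
    if "x \<in> dom_X \<alpha>" "y \<in> dom_X \<alpha>" for x y
    unfolding prod_kern by (intro tendsto_mult a prod_add_one_LIMSEQ b_summable that)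
  have summand: "coeff_c \<alpha> u * kern_star_set \<alpha> u x y = a * (\<Prod>j\<in>u. b x y j)" for u x y
    by (simp add: coeff_c_def kern_star_set_def b_def a_def prod.distrib)

  have "is_domain \<alpha> (dom_X \<alpha>)"
    unfolding is_domain_def prod_converges_def convergent_def
    using K_lim by (auto simp: dom_X_def)
  moreover have "Y \<subseteq> dom_X \<alpha>" if Y: "is_domain \<alpha> Y" for Y
  proof
    fix x assume x: "x \<in> Y"
    let ?k = "\<lambda>j. kern_star \<alpha> j (x j) (x j)"
    have k: "?k j \<ge> 0" if "j \<ge> 1" for j
      by (rule kernel_weights.kern_star_diagonal_nonneg[OF weights[OF that]])
    \<comment> \<open>Multiplying by the convergent product of the weights, rather than dividing by a limit,
      removes the factors \<open>\<alpha>\<^sub>0\<^sub>,\<^sub>j\<inverse>\<close>; the limit of the kernel products may be any real number.\<close>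
    have "convergent (\<lambda>J. (\<Prod>j=1..J. \<alpha> 0 j) * (\<Prod>j=1..J. kern \<alpha> j (x j) (x j)))"
      using Y x by (intro convergent_mult partial_prods_convergent[OF ii])
        (auto simp: is_domain_def prod_converges_def)
    moreover have "(\<Prod>j=1..J. \<alpha> 0 j) * (\<Prod>j=1..J. kern \<alpha> j (x j) (x j)) = (\<Prod>j=1..J. 1 + b x x j)" for J
      unfolding prod.distrib[symmetric]
    proof (rule prod.cong)
      fix j assume "j \<in> {1..J}"
      then show "\<alpha> 0 j * kern \<alpha> j (x j) (x j) = 1 + b x x j"
        using pos[of j 0] by (simp add: kern_eq)
    qed simp
    ultimately have "b x x summable_on {1..}"
      using k pos by (intro summable_if_prods_convergent) (auto simp: b_def less_imp_le)
    then have "(\<lambda>j. C * b x x j) summable_on {1..}"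
      by (rule summable_on_cmult_right)
    then have "?k summable_on {1..}"
    proof (rule summable_on_comparison_test)
      fix j :: nat assume "j \<in> {1..}"
      then have j: "j \<ge> 1" by simp
      have "?k j = inverse (\<alpha> 0 j) * b x x j" using pos[OF j, of 0] by (simp add: b_def)
      also have "\<dots> \<le> C * b x x j"
        using C(3)[OF j] k[OF j] pos[OF j, of 0] by (intro mult_right_mono) (auto simp: b_def)
      finally show "?k j \<le> C * b x x j" .
    qed (use k in auto)
    with x Y show "x \<in> dom_X \<alpha>" by (auto simp: dom_X_def is_domain_def)
  qed
  moreover have "(\<lambda>u. coeff_c \<alpha> u * kern_star_set \<alpha> u x y) abs_summable_on Fpow {1..} \<and>
      tensor_kernel \<alpha> x y = (\<Sum>\<^sub>\<infinity>u\<in>Fpow {1..}. coeff_c \<alpha> u * kern_star_set \<alpha> u x y)"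
    if x: "x \<in> dom_X \<alpha>" and y: "y \<in> dom_X \<alpha>" for x y
  proof
    have abs: "(\<lambda>u. \<Prod>j\<in>u. b x y j) abs_summable_on Fpow {1..}"
      by (intro finite_products_abs_summable b_summable x y)
    then show "(\<lambda>u. coeff_c \<alpha> u * kern_star_set \<alpha> u x y) abs_summable_on Fpow {1..}"
      unfolding summand norm_mult by (rule summable_on_cmult_right)
    have "tensor_kernel \<alpha> x y = a * (\<Sum>\<^sub>\<infinity>u\<in>Fpow {1..}. \<Prod>j\<in>u. b x y j)"
      unfolding tensor_kernel_def inf_prod_def by (rule limI[OF K_lim[OF x y]])
    also have "\<dots> = (\<Sum>\<^sub>\<infinity>u\<in>Fpow {1..}. coeff_c \<alpha> u * kern_star_set \<alpha> u x y)"
      unfolding summand by (rule infsum_cmult_right[symmetric]) (rule abs_summable_summable[OF abs])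
    finally show "tensor_kernel \<alpha> x y = \<dots>" .
  qed
  ultimately show ?thesis by (auto simp: is_maximal_domain_def)
qed

end
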